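(* Let $A\in\mathbb{R}^{n\times n}$. Then $A$ is an EP-matrix if and only if for any $t\ge 0$ and any $k\in\{1,\dots,n-1\}$ we have $$(\exp(A^{[k]}t))_{ii}>0\quad\text{for all } i\in\left\{1,\dots,\binom{n}{k}\right\}.$$
   Context: A matrix in $\mathbb{R}^{n\times n}$ is called a P-matrix if all its principal minors are positive. A matrix $A\in\mathbb{R}^{n\times n}$ is called an EP-matrix (exponential P-matrix) if $\exp(At)$ is a P-matrix for all $t\ge 0$. For $M\in\mathbb{R}^{n\times n}$ and $k\in\{1,\dots,n\}$, the $k$th multiplicative compound $M^{(k)}$ is the $\binom{n}{k}\times\binom{n}{k}$ matrix of all $k$-minors of $M$, with rows and columns indexed by the $k$-element subsets of $\{1,\dots,n\}$ (written as increasing sequences) in lexicographic order; the entry in position $(\alpha,\beta)$ is the determinant of the submatrix of $M$ with rows $\alpha$ and columns $\beta$. The $k$th additive compound of $A\in\mathbb{R}^{n\times n}$ is $A^{[k]}:=\frac{d}{d\varepsilon}(I+\varepsilon A)^{(k)}\big|_{\varepsilon=0}\in\mathbb{R}^{\binom{n}{k}\times\binom{n}{k}}$. *)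

theory Defs
  imports "HOL-Analysis.Derivative" "HOL-Library.List_Lexorder" "Jordan_Normal_Form.Determinant"
    "Jordan_Normal_Form.DL_Submatrix"
begin

text \<open>Matrices are those of \<open>Jordan_Normal_Form\<close>; rows, columns and index sets are counted from 0,
  so \<open>{1..n}\<close> becomes \<open>{..<n}\<close>.\<close>

text \<open>\<open>exp\<close> is not available for matrices with explicit carriers, so the exponential series is
  taken entrywise; it always converges (\<open>mat_exp_sums\<close>).\<close>

definition mat_exp :: "real mat \<Rightarrow> real mat" where
  "mat_exp A = mat (dim_row A) (dim_row A) (\<lambda>(i, j). \<Sum>m. (A ^\<^sub>m m) $$ (i, j) / fact m)"

definition P_matrix :: "real mat \<Rightarrow> bool" where
  "P_matrix M \<longleftrightarrow> square_mat M \<and>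
     (\<forall>I. I \<subseteq> {..<dim_row M} \<and> I \<noteq> {} \<longrightarrow> det (submatrix M I I) > 0)"

definition EP_matrix :: "real mat \<Rightarrow> bool" where
  "EP_matrix A \<longleftrightarrow> square_mat A \<and> (\<forall>t\<ge>0. P_matrix (mat_exp (t \<cdot>\<^sub>m A)))"

text \<open>The increasing sequences of length \<open>k\<close> in \<open>{..<n}\<close>, listed in the lexicographic order that
  \<open>List_Lexorder\<close> puts on lists.\<close>

definition incr_seqs :: "nat \<Rightarrow> nat \<Rightarrow> nat list list" where
  "incr_seqs n k =
     sorted_list_of_set {xs. length xs = k \<and> sorted_wrt (<) xs \<and> set xs \<subseteq> {..<n}}"

definition mult_compound :: "nat \<Rightarrow> real mat \<Rightarrow> real mat" where
  "mult_compound k M = mat (dim_row M choose k) (dim_col M choose k)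
     (\<lambda>(i, j). det (submatrix M (set (incr_seqs (dim_row M) k ! i))
                                (set (incr_seqs (dim_col M) k ! j))))"

text \<open>The derivative at \<open>\<epsilon> = 0\<close> is taken entrywise; every entry is differentiable
  (\<open>mult_compound_has_derivative\<close>).\<close>

definition add_compound :: "nat \<Rightarrow> real mat \<Rightarrow> real mat" where
  "add_compound k A = mat (dim_row A choose k) (dim_row A choose k)
     (\<lambda>(i, j). deriv (\<lambda>\<epsilon>. mult_compound k (1\<^sub>m (dim_row A) + \<epsilon> \<cdot>\<^sub>m A) $$ (i, j)) 0)"

lemma incr_seqs_bij:
  "bij_betw set {xs. length xs = k \<and> sorted_wrt (<) xs \<and> set xs \<subseteq> {..<n}}
     {I. I \<subseteq> {..<n::nat} \<and> card I = k}"
proof (rule bij_betw_byWitness[where f' = sorted_list_of_set], goal_cases)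
  case 1
  then show ?case
    by (auto simp: strict_sorted_iff sorted_list_of_set.idem_if_sorted_distinct)
next
  case 2
  then show ?case by (auto intro: set_sorted_list_of_set dest: finite_subset)
next
  case 3
  then show ?case by (auto simp: strict_sorted_iff distinct_card)
next
  case 4
  then show ?case using finite_subset[OF _ finite_lessThan, of _ n] by auto
qed

lemma incr_seqs:
  shows set_incr_seqs:
      "set (incr_seqs n k) = {xs. length xs = k \<and> sorted_wrt (<) xs \<and> set xs \<subseteq> {..<n}}"
    and sorted_incr_seqs: "sorted_wrt (<) (incr_seqs n k)"
    and length_incr_seqs: "length (incr_seqs n k) = n choose k"
proof -
  have "finite {I. I \<subseteq> {..<n} \<and> card I = k}" by simp
  then have fin: "finite {xs. length xs = k \<and> sorted_wrt (<) xs \<and> set xs \<subseteq> {..<n}}"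
    using bij_betw_finite[OF incr_seqs_bij] by blast
  then show "set (incr_seqs n k) = {xs. length xs = k \<and> sorted_wrt (<) xs \<and> set xs \<subseteq> {..<n}}"
    unfolding incr_seqs_def by simp
  show "sorted_wrt (<) (incr_seqs n k)" unfolding incr_seqs_def by simp
  show "length (incr_seqs n k) = n choose k"
    unfolding incr_seqs_def using bij_betw_same_card[OF incr_seqs_bij, of k n] n_subsets[of "{..<n}" k]
    by simp
qed

lemma pow_mat_entry_bound:
  fixes A :: "real mat"
  assumes A: "A \<in> carrier_mat n n" and "i < n" "j < n"
  shows "\<bar>(A ^\<^sub>m m) $$ (i, j)\<bar> \<le> (\<Sum>k<n. \<Sum>l<n. \<bar>A $$ (k, l)\<bar>) ^ m"
  using assms(2,3)
proof (induction m arbitrary: i j)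
  case 0
  then show ?case using A by auto
next
  case (Suc m)
  define C where "C = (\<Sum>k<n. \<Sum>l<n. \<bar>A $$ (k, l)\<bar>)"
  have C0: "C \<ge> 0" unfolding C_def by (intro sum_nonneg) auto
  have "(A ^\<^sub>m Suc m) $$ (i, j) = (\<Sum>k<n. (A ^\<^sub>m m) $$ (i, k) * A $$ (k, j))"
    using A Suc.prems by (auto simp: scalar_prod_def pow_carrier_mat atLeast0LessThan)
  also have "\<bar>\<dots>\<bar> \<le> (\<Sum>k<n. \<bar>(A ^\<^sub>m m) $$ (i, k)\<bar> * \<bar>A $$ (k, j)\<bar>)"
    by (rule order_trans[OF sum_abs]) (simp add: abs_mult)
  also have "\<dots> \<le> (\<Sum>k<n. C ^ m * (\<Sum>l<n. \<bar>A $$ (k, l)\<bar>))"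
    using Suc C0 unfolding C_def
    by (intro sum_mono mult_mono member_le_sum) auto
  also have "\<dots> = C ^ Suc m" unfolding C_def by (simp flip: sum_distrib_left)
  finally show ?case unfolding C_def .
qed

lemma mat_exp_sums:
  assumes A: "A \<in> carrier_mat n n" and ij: "i < n" "j < n"
  shows "(\<lambda>m. (A ^\<^sub>m m) $$ (i, j) / fact m) sums (mat_exp A $$ (i, j))"
proof -
  define C where "C = (\<Sum>k<n. \<Sum>l<n. \<bar>A $$ (k, l)\<bar>)"
  have "summable (\<lambda>m. C ^ m / fact m)"
    using summable_exp[of C] by (simp add: field_simps)
  then have "summable (\<lambda>m. (A ^\<^sub>m m) $$ (i, j) / fact m)"
    by (rule summable_comparison_test')
      (use pow_mat_entry_bound[OF A ij] in \<open>auto simp: C_def intro!: divide_right_mono\<close>)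
  then show ?thesis using A ij by (auto simp: mat_exp_def summable_sums)
qed

lemma mult_compound_has_derivative:
  assumes A: "A \<in> carrier_mat n n" and ij: "i < n choose k" "j < n choose k"
  shows "((\<lambda>\<epsilon>. mult_compound k (1\<^sub>m n + \<epsilon> \<cdot>\<^sub>m A) $$ (i, j))
           has_real_derivative add_compound k A $$ (i, j)) (at 0)"
proof -
  define I where "I = set (incr_seqs n k ! i)"
  define J where "J = set (incr_seqs n k ! j)"
  define a where "a = card {r. r < n \<and> r \<in> I}"
  define b where "b = card {r. r < n \<and> r \<in> J}"
  have eq: "mult_compound k (1\<^sub>m n + \<epsilon> \<cdot>\<^sub>m A) $$ (i, j)
      = (if a = b then \<Sum>p | p permutes {0..<a}. signof p *
           (\<Prod>r = 0..<a. 1\<^sub>m n $$ (pick I r, pick J (p r)) + \<epsilon> * A $$ (pick I r, pick J (p r))) else 0)"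
    for \<epsilon> :: real
  proof -
    have *: "submatrix (1\<^sub>m n + \<epsilon> \<cdot>\<^sub>m A) I J $$ (r, s)
       = 1\<^sub>m n $$ (pick I r, pick J s) + \<epsilon> * A $$ (pick I r, pick J s)" if "r < a" "s < b" for r s
      using that A pick_le[of r n I] pick_le[of s n J]
      by (subst submatrix_index) (auto simp: a_def b_def)
    have d: "dim_row (submatrix (1\<^sub>m n + \<epsilon> \<cdot>\<^sub>m A) I J) = a"
      "dim_col (submatrix (1\<^sub>m n + \<epsilon> \<cdot>\<^sub>m A) I J) = b"
      using A by (auto simp: dim_submatrix a_def b_def)
    have "mult_compound k (1\<^sub>m n + \<epsilon> \<cdot>\<^sub>m A) $$ (i, j)
        = det (submatrix (1\<^sub>m n + \<epsilon> \<cdot>\<^sub>m A) I J)"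
      using A ij by (simp add: mult_compound_def I_def J_def)
    also have "\<dots> = (if a = b then \<Sum>p | p permutes {0..<a}. signof p *
           (\<Prod>r = 0..<a. 1\<^sub>m n $$ (pick I r, pick J (p r)) + \<epsilon> * A $$ (pick I r, pick J (p r))) else 0)"
      unfolding det_def d
      by (auto intro!: sum.cong prod.cong * simp: permutes_in_image dest: permutes_in_image)
    finally show ?thesis .
  qed
  have prod: "(\<lambda>x::real. \<Prod>r\<in>S. f r x) differentiable (at 0)"
    if "finite S" "\<And>r. f r differentiable (at 0)" for S :: "nat set" and f :: "nat \<Rightarrow> real \<Rightarrow> real"
    using that(1) by induction (auto intro!: differentiable_mult that(2))
  have "(\<lambda>\<epsilon>. mult_compound k (1\<^sub>m n + \<epsilon> \<cdot>\<^sub>m A) $$ (i, j)) differentiable (at 0)"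
    unfolding eq
    by (cases "a = b")
      (auto intro!: differentiable_sum differentiable_mult prod differentiable_add finite_permutations)
  then have "(\<lambda>\<epsilon>. mult_compound k (1\<^sub>m n + \<epsilon> \<cdot>\<^sub>m A) $$ (i, j)) field_differentiable (at 0)"
    using field_differentiable_def real_differentiable_def by blast
  then show ?thesis
    using A ij by (simp add: add_compound_def DERIV_deriv_iff_field_differentiable)
qed

end

theory Submission
  imports Defs
begin

text \<open>By the Cauchy--Binet formula, \<open>t \<mapsto> (exp(At))^(k)\<close> is a one-parameter group of matrices, and its
  derivative at \<open>0\<close> is the \<open>k\<close>th additive compound of \<open>A\<close>. A one-parameter group is determined by
  its derivative at \<open>0\<close>, so \<open>(exp(At))^(k)\<close> is the exponential of \<open>t\<close> times the additive compound, and
  the diagonal entries of the latter are the principal \<open>k\<close>-minors of \<open>exp(At)\<close>. The minor with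
  \<open>k = n\<close> needs no condition because \<open>det(exp(At)) = (det(exp(At/2)))\<^sup>2\<close> is nonzero.\<close>

section \<open>Submatrices and the Cauchy-Binet formula\<close>

lemma bij_betw_pick:
  assumes "finite S"
  shows "bij_betw (pick S) {0..<card S} S"
proof (rule bij_betw_imageI)
  show inj: "inj_on (pick S) {0..<card S}"
    by (rule inj_onI) (metis atLeastLessThan_iff less_irrefl linorder_less_linear pick_mono_le)
  show "pick S ` {0..<card S} = S"
    using assms inj by (intro card_subset_eq) (auto simp: card_image intro: pick_in_set_le)
qed

lemma submatrix_eq_mat:
  assumes "M \<in> carrier_mat m n" "I \<subseteq> {..<m}" "J \<subseteq> {..<n}"
  shows "submatrix M I J = mat (card I) (card J) (\<lambda>(r, s). M $$ (pick I r, pick J s))"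
proof -
  have "{i. i < m \<and> i \<in> I} = I" "{j. j < n \<and> j \<in> J} = J" using assms by auto
  then show ?thesis using assms(1) by (simp add: submatrix_def)
qed

text \<open>Multiplying out the row sums in the Leibniz formula produces one term for each choice
  \<open>h\<close> of an inner index per row. For fixed \<open>h\<close> the entries of
  \<open>M\<close> do not involve the permutation, and the remaining sum is again a Leibniz formula,
  for the rows of \<open>N\<close> chosen by \<open>h\<close>.\<close>

lemma det_mat_mult_expand:
  fixes M N :: "'a :: comm_ring_1 mat"
  assumes M: "M \<in> carrier_mat m n" and N: "N \<in> carrier_mat n l"
    and f: "\<And>r. r < k \<Longrightarrow> f r < m" and g: "\<And>s. s < k \<Longrightarrow> g s < l"
  shows "det (mat k k (\<lambda>(r, s). (M * N) $$ (f r, g s))) =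
    (\<Sum>h \<in> {0..<k} \<rightarrow>\<^sub>E {0..<n}.
      (\<Prod>r = 0..<k. M $$ (f r, h r)) * det (mat k k (\<lambda>(r, s). N $$ (h r, g s))))"
proof -
  have "det (mat k k (\<lambda>(r, s). (M * N) $$ (f r, g s))) =
      (\<Sum>p | p permutes {0..<k}. signof p *
        (\<Prod>r = 0..<k. \<Sum>j \<in> {0..<n}. M $$ (f r, j) * N $$ (j, g (p r))))"
    using assms
    by (auto simp: det_def scalar_prod_def permutes_in_image intro!: sum.cong prod.cong
        arg_cong2[of _ _ _ _ "(*)"])
  also have "\<dots> = (\<Sum>p | p permutes {0..<k}. \<Sum>h \<in> {0..<k} \<rightarrow>\<^sub>E {0..<n}.
      (\<Prod>r = 0..<k. M $$ (f r, h r)) * (signof p * (\<Prod>r = 0..<k. N $$ (h r, g (p r)))))"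
    by (simp add: prod_sum_PiE prod.distrib sum_distrib_left mult_ac)
  also have "\<dots> = (\<Sum>h \<in> {0..<k} \<rightarrow>\<^sub>E {0..<n}. (\<Prod>r = 0..<k. M $$ (f r, h r)) *
      (\<Sum>p | p permutes {0..<k}. signof p * (\<Prod>r = 0..<k. N $$ (h r, g (p r)))))"
    by (subst sum.swap) (simp add: sum_distrib_left)
  also have "\<dots> = (\<Sum>h \<in> {0..<k} \<rightarrow>\<^sub>E {0..<n}.
      (\<Prod>r = 0..<k. M $$ (f r, h r)) * det (mat k k (\<lambda>(r, s). N $$ (h r, g s))))"
    by (auto simp: det_def permutes_in_image intro!: sum.cong prod.cong
        arg_cong2[of _ _ _ _ "(*)"])
  finally show ?thesis .
qed

text \<open>Relative to one enumeration \<open>e\<close> of \<open>H\<close>, any other differs by a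
  unique permutation of \<open>S\<close>. The \<open>restrict\<close> is there because functions in
  \<open>PiE\<close> are \<open>undefined\<close> outside \<open>S\<close>, whereas a permutation is
  the identity there.\<close>

lemma bij_betw_permutes_comp:
  assumes e: "bij_betw e S H"
  shows "bij_betw (\<lambda>p. restrict (e \<circ> p) S) {p. p permutes S} {h \<in> S \<rightarrow>\<^sub>E H. bij_betw h S H}"
proof (rule bij_betwI[where g = "\<lambda>h r. if r \<in> S then inv_into S e (h r) else r"], goal_cases)
  case 1
  have "bij_betw (restrict (e \<circ> p) S) S H" if "p permutes S" for p
    using bij_betw_trans[OF permutes_imp_bij[OF that] e] by (simp cong: bij_betw_cong)
  then show ?case using e by (auto simp: bij_betw_def permutes_in_image)
next
  case 2
  have "(\<lambda>r. if r \<in> S then inv_into S e (h r) else r) permutes S" if h: "bij_betw h S H" for h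
  proof (rule bij_imp_permutes)
    have "bij_betw (inv_into S e \<circ> h) S S"
      using bij_betw_trans[OF h bij_betw_inv_into[OF e]] .
    then show "bij_betw (\<lambda>r. if r \<in> S then inv_into S e (h r) else r) S S"
      by (simp add: o_def cong: bij_betw_cong)
  qed auto
  then show ?case by auto
next
  case (3 p)
  then show ?case using e
    by (auto simp: fun_eq_iff permutes_in_image bij_betw_def permutes_not_in)
next
  case (4 h)
  then have "e (inv_into S e (h r)) = h r" if "r \<in> S" for r
    using that bij_betw_inv_into_right[OF e] by auto
  with 4 show ?case by (intro extensionalityI[of _ S]) (auto simp: PiE_def)
qed

text \<open>In the expansion over all index choices \<open>h\<close> only the injective ones
  survive. Those with image \<open>H\<close> are the permutations of the increasing enumeration of
  \<open>H\<close>, and together they contribute the product of the two minors belonging to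
  \<open>H\<close>.\<close>

lemma Cauchy_Binet:
  fixes M N :: "'a :: comm_ring_1 mat"
  assumes M: "M \<in> carrier_mat m n" and N: "N \<in> carrier_mat n l"
    and I: "I \<subseteq> {..<m}" "card I = k" and J: "J \<subseteq> {..<l}" "card J = k"
  shows "det (submatrix (M * N) I J) =
    (\<Sum>H | H \<subseteq> {..<n} \<and> card H = k. det (submatrix M I H) * det (submatrix N H J))"
proof -
  define D where "D h = det (mat k k (\<lambda>(r, s). N $$ (h r, pick J s)))" for h
  define P where "P h = (\<Prod>r = 0..<k. M $$ (pick I r, h r))" for h
  define F where "F = {h \<in> {0..<k} \<rightarrow>\<^sub>E {0..<n}. inj_on h {0..<k}}"
  have pI: "pick I r < m" if "r < k" for r
    using that I pick_in_set_le[of r I] by auto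
  have pJ: "pick J r < l" if "r < k" for r
    using that J pick_in_set_le[of r J] by auto
  have MN: "M * N \<in> carrier_mat m l" using M N by simp
  have "det (submatrix (M * N) I J) = det (mat k k (\<lambda>(r, s). (M * N) $$ (pick I r, pick J s)))"
    by (simp add: submatrix_eq_mat[OF MN I(1) J(1)] I J)
  also have "\<dots> = (\<Sum>h \<in> {0..<k} \<rightarrow>\<^sub>E {0..<n}. P h * D h)"
    unfolding D_def P_def by (rule det_mat_mult_expand[OF M N pI pJ])
  also have "\<dots> = (\<Sum>h \<in> F. P h * D h)" \<comment> \<open>the other \<open>h\<close> give two equal rows\<close>
  proof (rule sum.mono_neutral_right)
    show "\<forall>h \<in> ({0..<k} \<rightarrow>\<^sub>E {0..<n}) - F. P h * D h = 0"
    proof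
      fix h assume "h \<in> ({0..<k} \<rightarrow>\<^sub>E {0..<n}) - F"
      then obtain r s where rs: "r < k" "s < k" "r \<noteq> s" "h r = h s"
        by (auto simp: F_def inj_on_def)
      have "D h = 0" unfolding D_def
        by (rule det_identical_rows[OF _ rs(3,1,2)]) (use rs in \<open>auto intro!: eq_vecI\<close>)
      then show "P h * D h = 0" by simp
    qed
  qed (auto simp: F_def intro!: finite_PiE)
  \<comment> \<open>Each injective \<open>h\<close> is sorted by its image, which is a
    \<open>k\<close>-subset of the inner indices.\<close>
  also have "\<dots> = (\<Sum>H | H \<subseteq> {..<n} \<and> card H = k. \<Sum>h | h \<in> F \<and> h ` {0..<k} = H. P h * D h)"
    by (rule sum.group[symmetric])
      (auto simp: F_def card_image intro!: finite_PiE intro: finite_subset[of _ "{0..<k} \<rightarrow>\<^sub>E {0..<n}"])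
  also have "\<dots> = (\<Sum>H | H \<subseteq> {..<n} \<and> card H = k. det (submatrix M I H) * det (submatrix N H J))"
  proof (rule sum.cong[OF refl], clarify)
    fix H assume H: "H \<subseteq> {..<n}" "k = card H"
    have e: "bij_betw (pick H) {0..<k} H"
      using bij_betw_pick H finite_subset by blast
    have "{h. h \<in> F \<and> h ` {0..<k} = H} = {h \<in> {0..<k} \<rightarrow>\<^sub>E H. bij_betw h {0..<k} H}"
      using H by (auto simp: F_def bij_betw_def PiE_iff Pi_iff subset_iff)
    then have "(\<Sum>h | h \<in> F \<and> h ` {0..<k} = H. P h * D h)
        = (\<Sum>p | p permutes {0..<k}. P (restrict (pick H \<circ> p) {0..<k}) * D (restrict (pick H \<circ> p) {0..<k}))"
      using sum.reindex_bij_betw[OF bij_betw_permutes_comp[OF e], of "\<lambda>h. P h * D h"] by simp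
    also have "\<dots> = (\<Sum>p | p permutes {0..<k}.
        signof p * (\<Prod>r = 0..<k. M $$ (pick I r, pick H (p r))) * det (submatrix N H J))"
    proof (rule sum.cong[OF refl], clarify)
      fix p assume p: "p permutes {0..<k}"
      let ?N = "mat k k (\<lambda>(r, s). N $$ (pick H r, pick J s))"
      have "P (restrict (pick H \<circ> p) {0..<k}) = (\<Prod>r = 0..<k. M $$ (pick I r, pick H (p r)))"
        by (simp add: P_def)
      \<comment> \<open>Choosing rows by \<open>pick H\<close> after \<open>p\<close> permutes the
        rows of the minor of \<open>N\<close> with row set \<open>H\<close>, which costs the sign of
        \<open>p\<close>.\<close>
      moreover have "D (restrict (pick H \<circ> p) {0..<k}) = det (mat k k (\<lambda>(r, s). ?N $$ (p r, s)))"
        unfolding D_def using p permutes_in_image[OF p] by (intro arg_cong[of _ _ det] eq_matI) auto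
      moreover have "\<dots> = signof p * det ?N"
        by (rule det_permute_rows[OF _ p]) simp
      moreover have "?N = submatrix N H J"
        using submatrix_eq_mat[OF N H(1) J(1)] H J by simp
      ultimately show "P (restrict (pick H \<circ> p) {0..<k}) * D (restrict (pick H \<circ> p) {0..<k}) =
          signof p * (\<Prod>r = 0..<k. M $$ (pick I r, pick H (p r))) * det (submatrix N H J)"
        by (simp only: mult_ac)
    qed
    \<comment> \<open>The signs and the products of entries of \<open>M\<close> form the Leibniz
      formula of \<open>submatrix M I H\<close>.\<close>
    also have "\<dots> = det (submatrix M I H) * det (submatrix N H J)"
      using submatrix_eq_mat[OF M I(1) H(1)] H I
      by (auto simp: det_def permutes_in_image sum_distrib_right intro!: sum.cong prod.cong
          arg_cong2[of _ _ _ _ "(*)"])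
    finally show "(\<Sum>h | h \<in> F \<and> h ` {0..<card H} = H. P h * D h) =
        det (submatrix M I H) * det (submatrix N H J)" by (simp add: H)
  qed
  finally show ?thesis .
qed

section \<open>Multiplicative compounds of products and of the identity\<close>

lemma bij_betw_incr_seqs:
  "bij_betw (\<lambda>i. set (incr_seqs n k ! i)) {..<n choose k} {I. I \<subseteq> {..<n} \<and> card I = k}"
proof -
  have "bij_betw ((!) (incr_seqs n k)) {..<n choose k} (set (incr_seqs n k))"
    using sorted_incr_seqs[of n k]
    by (intro bij_betw_nth) (simp_all add: length_incr_seqs strict_sorted_iff)
  from bij_betw_trans[OF this[unfolded set_incr_seqs] incr_seqs_bij] show ?thesis
    by (simp add: o_def)
qed

lemma incr_seqs_nth:
  assumes "i < n choose k"
  shows "set (incr_seqs n k ! i) \<subseteq> {..<n}" "card (set (incr_seqs n k ! i)) = k"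
  using bij_betw_apply[OF bij_betw_incr_seqs] assms by auto

lemma mult_compound_carrier [simp]:
  "M \<in> carrier_mat m n \<Longrightarrow> mult_compound k M \<in> carrier_mat (m choose k) (n choose k)"
  by (simp add: mult_compound_def)

text \<open>The Cauchy-Binet sum over \<open>k\<close>-subsets becomes the row-by-column sum of the
  compounds once the subsets are numbered by \<open>incr_seqs\<close>.\<close>

lemma mult_compound_mult:
  assumes M: "M \<in> carrier_mat m n" and N: "N \<in> carrier_mat n l"
  shows "mult_compound k (M * N) = mult_compound k M * mult_compound k N"
proof (rule eq_matI)
  fix i j assume "i < dim_row (mult_compound k M * mult_compound k N)"
    "j < dim_col (mult_compound k M * mult_compound k N)"
  then have ij: "i < m choose k" "j < l choose k"
    using M N by (auto simp: mult_compound_def)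
  let ?I = "\<lambda>m i. set (incr_seqs m k ! i)"
  have "mult_compound k (M * N) $$ (i, j) = det (submatrix (M * N) (?I m i) (?I l j))"
    using M N ij by (simp add: mult_compound_def)
  also have "\<dots> = (\<Sum>H | H \<subseteq> {..<n} \<and> card H = k.
      det (submatrix M (?I m i) H) * det (submatrix N H (?I l j)))"
    by (rule Cauchy_Binet[OF M N]) (use ij incr_seqs_nth in auto)
  also have "\<dots> = (\<Sum>h < n choose k.
      det (submatrix M (?I m i) (?I n h)) * det (submatrix N (?I n h) (?I l j)))"
    by (rule sum.reindex_bij_betw[OF bij_betw_incr_seqs, symmetric])
  also have "\<dots> = (mult_compound k M * mult_compound k N) $$ (i, j)"
    using M N ij by (simp add: mult_compound_def scalar_prod_def atLeast0LessThan)
  finally show "mult_compound k (M * N) $$ (i, j) = (mult_compound k M * mult_compound k N) $$ (i, j)" .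
qed (use M N in \<open>auto simp: mult_compound_def\<close>)

lemma mult_compound_one: "mult_compound k (1\<^sub>m n) = 1\<^sub>m (n choose k)"
proof (rule eq_matI)
  fix i j assume "i < dim_row (1\<^sub>m (n choose k) :: real mat)" "j < dim_col (1\<^sub>m (n choose k) :: real mat)"
  then have ij: "i < n choose k" "j < n choose k" by auto
  define I where "I = set (incr_seqs n k ! i)"
  define J where "J = set (incr_seqs n k ! j)"
  have I: "I \<subseteq> {..<n}" "card I = k" and J: "J \<subseteq> {..<n}" "card J = k"
    using incr_seqs_nth ij by (auto simp: I_def J_def)
  have bI: "bij_betw (pick I) {0..<k} I" and bJ: "bij_betw (pick J) {0..<k} J"
    using bij_betw_pick[of I] bij_betw_pick[of J] I J finite_subset[of _ "{..<n}"] by auto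
  have pI: "pick I r \<in> I" "pick I r < n" if "r < k" for r
    using that I pick_in_set_le[of r I] by auto
  have pJ: "pick J r \<in> J" "pick J r < n" if "r < k" for r
    using that J pick_in_set_le[of r J] by auto
  have sub: "submatrix (1\<^sub>m n :: real mat) I J = mat k k (\<lambda>(r, s). 1\<^sub>m n $$ (pick I r, pick J s))"
    using submatrix_eq_mat[OF one_carrier_mat I(1) J(1)] I J by simp
  have "det (submatrix (1\<^sub>m n :: real mat) I J) = (if i = j then 1 else 0)"
  proof (cases "i = j")
    case True
    have "submatrix (1\<^sub>m n :: real mat) I J = 1\<^sub>m k"
      unfolding sub using True pI inj_onD[OF bij_betw_imp_inj_on[OF bI]]
      by (intro eq_matI) (auto simp: I_def J_def)
    then show ?thesis using True by simp
  next
    case False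
    then have "I \<noteq> J"
      using ij bij_betw_imp_inj_on[OF bij_betw_incr_seqs] by (auto simp: I_def J_def inj_on_def)
    \<comment> \<open>Sets of equal finite size cannot be properly included in one another, so some
      element of \<open>I\<close> lies outside \<open>J\<close>. The row of the submatrix belonging
      to it is zero, and every Leibniz product has a factor from that row.\<close>
    then have "\<not> I \<subseteq> J" using I J by (metis card_subset_eq finite_lessThan finite_subset)
    then obtain r where r: "r < k" "pick I r \<notin> J"
      using bij_betw_imp_surj_on[OF bI] by force
    have "(\<Prod>s = 0..<k. submatrix (1\<^sub>m n :: real mat) I J $$ (s, p s)) = 0"
      if "p permutes {0..<k}" for p
    proof (rule prod_zero)
      have "p r < k" using permutes_in_image[OF that, of r] r by simp
      then show "\<exists>s\<in>{0..<k}. submatrix (1\<^sub>m n :: real mat) I J $$ (s, p s) = 0"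
        using r pI pJ by (intro bexI[of _ r]) (auto simp: sub)
    qed simp
    moreover have "submatrix (1\<^sub>m n :: real mat) I J \<in> carrier_mat k k" by (simp add: sub)
    ultimately show ?thesis using False by (subst det_def') (auto simp del: prod_zero_iff intro!: sum.neutral)
  qed
  then show "mult_compound k (1\<^sub>m n) $$ (i, j) = 1\<^sub>m (n choose k) $$ (i, j)"
    using ij by (simp add: mult_compound_def I_def J_def)
qed (auto simp: mult_compound_def)

section \<open>Matrix powers and the exponential series\<close>

lemma pow_mat_smult:
  assumes "A \<in> carrier_mat n n"
  shows "(c \<cdot>\<^sub>m A) ^\<^sub>m m = (c ^ m :: 'a :: comm_ring_1) \<cdot>\<^sub>m (A ^\<^sub>m m)"
proof (induction m)
  case (Suc m)
  then show ?case using assms pow_carrier_mat[OF assms, of m]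
    by (intro eq_matI) (auto simp: mult_smult_assoc_mat[of _ n n] mult_smult_distrib[of _ n n] mult_ac)
qed (use assms in auto)

lemma pow_mat_add:
  assumes "A \<in> carrier_mat n n"
  shows "A ^\<^sub>m (k + m) = A ^\<^sub>m k * (A ^\<^sub>m m :: 'a :: semiring_1 mat)"
proof (induction m)
  case (Suc m)
  have "A ^\<^sub>m (k + Suc m) = A ^\<^sub>m k * A ^\<^sub>m m * A" by (simp add: Suc)
  also have "\<dots> = A ^\<^sub>m k * A ^\<^sub>m Suc m"
    using assms pow_carrier_mat[OF assms] by (simp add: assoc_mult_mat[of _ n n _ n _ n])
  finally show ?case .
qed (use assms in auto)

lemma index_mult_mat_sum:
  assumes "M \<in> carrier_mat m n" "N \<in> carrier_mat n l" "i < m" "j < l"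
  shows "(M * N) $$ (i, j) = (\<Sum>k<n. M $$ (i, k) * N $$ (k, j))"
  using assms by (simp add: scalar_prod_def atLeast0LessThan)

lemma mat_exp_carrier [simp]: "A \<in> carrier_mat n n \<Longrightarrow> mat_exp A \<in> carrier_mat n n"
  by (simp add: mat_exp_def)

text \<open>This form exhibits each entry as a power series in \<open>t\<close>, to which Cauchy
  products and termwise differentiation apply.\<close>

lemma mat_exp_smult_sums:
  fixes A :: "real mat"
  assumes A: "A \<in> carrier_mat n n" and ij: "i < n" "j < n"
  shows "(\<lambda>m. (A ^\<^sub>m m) $$ (i, j) / fact m * t ^ m) sums (mat_exp (t \<cdot>\<^sub>m A) $$ (i, j))"
proof -
  have "((t \<cdot>\<^sub>m A) ^\<^sub>m m) $$ (i, j) / fact m = (A ^\<^sub>m m) $$ (i, j) / fact m * t ^ m" for m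
    using carrier_matD[OF pow_carrier_mat[OF A, of m]] ij by (simp add: pow_mat_smult[OF A])
  then show ?thesis using mat_exp_sums[of "t \<cdot>\<^sub>m A" n i j] A ij by simp
qed

text \<open>Absolute convergence justifies the Cauchy products in \<open>mat_exp_add\<close>; the
  majorant is the scalar exponential series at \<open>C * \<bar>t\<bar>\<close>.\<close>

lemma mat_exp_abs_summable:
  fixes A :: "real mat"
  assumes A: "A \<in> carrier_mat n n" and ij: "i < n" "j < n"
  shows "summable (\<lambda>m. norm ((A ^\<^sub>m m) $$ (i, j) / fact m * t ^ m))"
proof -
  define C where "C = (\<Sum>k<n. \<Sum>l<n. \<bar>A $$ (k, l)\<bar>)"
  have "summable (\<lambda>m. (C * \<bar>t\<bar>) ^ m / fact m)"
    using summable_exp[of "C * \<bar>t\<bar>"] by (simp add: field_simps)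
  then show ?thesis
  proof (rule summable_comparison_test')
    fix m
    show "norm (norm ((A ^\<^sub>m m) $$ (i, j) / fact m * t ^ m)) \<le> (C * \<bar>t\<bar>) ^ m / fact m"
      using pow_mat_entry_bound[OF A ij, of m]
      by (auto simp: C_def abs_mult power_abs power_mult_distrib intro!: divide_right_mono mult_right_mono)
  qed
qed

lemma mat_exp_add:
  fixes A :: "real mat"
  assumes A: "A \<in> carrier_mat n n"
  shows "mat_exp ((s + t) \<cdot>\<^sub>m A) = mat_exp (s \<cdot>\<^sub>m A) * mat_exp (t \<cdot>\<^sub>m A)"
proof (rule eq_matI)
  fix i j
  assume "i < dim_row (mat_exp (s \<cdot>\<^sub>m A) * mat_exp (t \<cdot>\<^sub>m A))"
    "j < dim_col (mat_exp (s \<cdot>\<^sub>m A) * mat_exp (t \<cdot>\<^sub>m A))"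
  then have ij: "i < n" "j < n" using A by (auto simp: mat_exp_def)
  define c where "c t i j m = (A ^\<^sub>m m) $$ (i, j) / fact m * t ^ m" for t :: real and i j m
  have suminf: "(\<Sum>m. c t i j m) = mat_exp (t \<cdot>\<^sub>m A) $$ (i, j)" if "i < n" "j < n" for t i j
    using mat_exp_smult_sums[OF A that] by (auto simp: c_def sums_iff)
  have abs: "summable (\<lambda>m. norm (c t i j m))" if "i < n" "j < n" for t i j
    unfolding c_def by (rule mat_exp_abs_summable[OF A that])
  have "(\<lambda>m. \<Sum>l<n. \<Sum>p\<le>m. c s i l p * c t l j (m - p)) sums
      (\<Sum>l<n. mat_exp (s \<cdot>\<^sub>m A) $$ (i, l) * mat_exp (t \<cdot>\<^sub>m A) $$ (l, j))"
  proof (rule sums_sum)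
    fix l assume "l \<in> {..<n}"
    then have l: "l < n" by simp
    show "(\<lambda>m. \<Sum>p\<le>m. c s i l p * c t l j (m - p)) sums
        (mat_exp (s \<cdot>\<^sub>m A) $$ (i, l) * mat_exp (t \<cdot>\<^sub>m A) $$ (l, j))"
      using Cauchy_product_sums[OF abs abs, of i l l j s t] ij l by (simp only: suminf)
  qed
  also have "(\<Sum>l<n. mat_exp (s \<cdot>\<^sub>m A) $$ (i, l) * mat_exp (t \<cdot>\<^sub>m A) $$ (l, j)) =
      (mat_exp (s \<cdot>\<^sub>m A) * mat_exp (t \<cdot>\<^sub>m A)) $$ (i, j)"
    using A ij by (intro index_mult_mat_sum[symmetric]) auto
  also have "(\<lambda>m. \<Sum>l<n. \<Sum>p\<le>m. c s i l p * c t l j (m - p)) = c (s + t) i j"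
  proof
    fix m
    have "(\<Sum>l<n. \<Sum>p\<le>m. c s i l p * c t l j (m - p)) =
        (\<Sum>p\<le>m. \<Sum>l<n. c s i l p * c t l j (m - p))"
      by (rule sum.swap)
    \<comment> \<open>Summation over \<open>l\<close> joins the powers \<open>p\<close> and
      \<open>m - p\<close> of \<open>A\<close> into the power \<open>m\<close>, and the two
      reciprocal factorials combine to \<open>(m choose p) / fact m\<close>. The binomial theorem
      then collects the powers of \<open>s\<close> and \<open>t\<close>.\<close>
    also have "\<dots> = (\<Sum>p\<le>m. (A ^\<^sub>m m) $$ (i, j) / fact m * (of_nat (m choose p) * s ^ p * t ^ (m - p)))"
    proof (rule sum.cong[OF refl])
      fix p assume "p \<in> {..m}"
      then have p: "p \<le> m" by simp
      have "(A ^\<^sub>m m) $$ (i, j) = (\<Sum>l<n. (A ^\<^sub>m p) $$ (i, l) * (A ^\<^sub>m (m - p)) $$ (l, j))"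
        using pow_mat_add[OF A, of p "m - p"] p ij
        by (simp only: le_add_diff_inverse index_mult_mat_sum[OF pow_carrier_mat[OF A] pow_carrier_mat[OF A]])
      then show "(\<Sum>l<n. c s i l p * c t l j (m - p)) =
          (A ^\<^sub>m m) $$ (i, j) / fact m * (of_nat (m choose p) * s ^ p * t ^ (m - p))"
        by (simp add: c_def binomial_fact[OF p] sum_distrib_left sum_distrib_right sum_divide_distrib mult_ac)
    qed
    also have "\<dots> = c (s + t) i j m"
      by (simp add: c_def binomial_ring sum_distrib_left)
    finally show "(\<Sum>l<n. \<Sum>p\<le>m. c s i l p * c t l j (m - p)) = c (s + t) i j m" .
  qed
  finally show "mat_exp ((s + t) \<cdot>\<^sub>m A) $$ (i, j) = (mat_exp (s \<cdot>\<^sub>m A) * mat_exp (t \<cdot>\<^sub>m A)) $$ (i, j)"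
    using suminf[OF ij] by (simp add: sums_iff)
qed (use A in \<open>auto simp: mat_exp_def\<close>)

lemma mat_exp_has_derivative_0:
  fixes A :: "real mat"
  assumes A: "A \<in> carrier_mat n n" and ij: "i < n" "j < n"
  shows "((\<lambda>t. mat_exp (t \<cdot>\<^sub>m A) $$ (i, j)) has_real_derivative A $$ (i, j)) (at 0)"
proof -
  define c where "c m = (A ^\<^sub>m m) $$ (i, j) / fact m" for m
  have sums: "(\<lambda>m. c m * t ^ m) sums (mat_exp (t \<cdot>\<^sub>m A) $$ (i, j))" for t
    using mat_exp_smult_sums[OF A ij] by (simp add: c_def)
  have "((\<lambda>t. \<Sum>m. c m * t ^ m) has_field_derivative (\<Sum>m. diffs c m * 0 ^ m)) (at 0)"
    using sums by (intro termdiffs_strong_converges_everywhere) (auto simp: sums_iff)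
  also have "(\<lambda>t. \<Sum>m. c m * t ^ m) = (\<lambda>t. mat_exp (t \<cdot>\<^sub>m A) $$ (i, j))"
    using sums by (auto simp: sums_iff)
  \<comment> \<open>As \<open>0 ^ 0 = 1\<close>, only \<open>diffs c 0\<close> remains, which is
    \<open>c 1\<close>, the linear coefficient.\<close>
  also have "(\<Sum>m. diffs c m * 0 ^ m) = A $$ (i, j)"
    unfolding powser_zero using A ij by (simp add: diffs_def c_def)
  finally show ?thesis .
qed

lemma mat_exp_zero:
  fixes A :: "real mat"
  assumes A: "A \<in> carrier_mat n n"
  shows "mat_exp (0 \<cdot>\<^sub>m A) = 1\<^sub>m n"
proof (rule eq_matI)
  fix i j assume "i < dim_row (1\<^sub>m n :: real mat)" "j < dim_col (1\<^sub>m n :: real mat)"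
  then have ij: "i < n" "j < n" by auto
  have "mat_exp (0 \<cdot>\<^sub>m A) $$ (i, j) = (\<Sum>m. (A ^\<^sub>m m) $$ (i, j) / fact m * 0 ^ m)"
    using mat_exp_smult_sums[OF A ij, of 0] by (simp only: sums_iff)
  also have "\<dots> = 1\<^sub>m n $$ (i, j)"
    unfolding powser_zero using A ij by simp
  finally show "mat_exp (0 \<cdot>\<^sub>m A) $$ (i, j) = 1\<^sub>m n $$ (i, j)" .
qed (use A in \<open>auto simp: mat_exp_def\<close>)

section \<open>One-parameter groups and their generators\<close>

text \<open>\<open>B\<close> is the infinitesimal generator. Differentiability is demanded at 0
  only; the group law carries it to all other points.\<close>

definition one_parameter_group :: "nat \<Rightarrow> (real \<Rightarrow> real mat) \<Rightarrow> real mat \<Rightarrow> bool" where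
  "one_parameter_group n X B \<longleftrightarrow> B \<in> carrier_mat n n \<and> (\<forall>t. X t \<in> carrier_mat n n) \<and> X 0 = 1\<^sub>m n \<and>
     (\<forall>s t. X (s + t) = X s * X t) \<and>
     (\<forall>i<n. \<forall>j<n. ((\<lambda>t. X t $$ (i, j)) has_real_derivative B $$ (i, j)) (at 0))"

lemma one_parameter_group_mat_exp:
  "A \<in> carrier_mat n n \<Longrightarrow> one_parameter_group n (\<lambda>t. mat_exp (t \<cdot>\<^sub>m A)) A"
  by (auto simp: one_parameter_group_def mat_exp_zero mat_exp_add intro: mat_exp_has_derivative_0)

text \<open>Since addition commutes, \<open>X (h + t)\<close> equals both \<open>X t * X h\<close>
  and \<open>X h * X t\<close>. Differentiating in \<open>h\<close> at 0 leaves \<open>B\<close> on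
  the right or on the left.\<close>

lemma one_parameter_group_deriv:
  assumes X: "one_parameter_group n X B" and ij: "i < n" "j < n"
  shows one_parameter_group_deriv_right:
      "((\<lambda>t. X t $$ (i, j)) has_real_derivative (X t * B) $$ (i, j)) (at t)"
    and one_parameter_group_deriv_left:
      "((\<lambda>t. X t $$ (i, j)) has_real_derivative (B * X t) $$ (i, j)) (at t)"
proof -
  have carr: "X s \<in> carrier_mat n n" "B \<in> carrier_mat n n" for s
    using X by (auto simp: one_parameter_group_def)
  have add: "X (s + u) = X s * X u" for s u
    using X by (auto simp: one_parameter_group_def)
  have der: "((\<lambda>h. X h $$ (k, l)) has_real_derivative B $$ (k, l)) (at 0)" if "k < n" "l < n" for k l
    using X that by (auto simp: one_parameter_group_def)
  have "((\<lambda>h. \<Sum>l<n. X t $$ (i, l) * X h $$ (l, j)) has_real_derivative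
      (\<Sum>l<n. X t $$ (i, l) * B $$ (l, j))) (at 0)"
    by (intro DERIV_sum DERIV_cmult der) (use ij in auto)
  moreover have "X (h + t) = X t * X h" for h
    using add[of t h] by (simp add: add.commute)
  ultimately show "((\<lambda>t. X t $$ (i, j)) has_real_derivative (X t * B) $$ (i, j)) (at t)"
    using DERIV_shift[of "\<lambda>t. X t $$ (i, j)" "(X t * B) $$ (i, j)" 0 t] ij
    by (simp only: add_0
        index_mult_mat_sum[OF carr(1) carr(1)] index_mult_mat_sum[OF carr])
  have "((\<lambda>h. \<Sum>l<n. X h $$ (i, l) * X t $$ (l, j)) has_real_derivative
      (\<Sum>l<n. B $$ (i, l) * X t $$ (l, j))) (at 0)"
    by (intro DERIV_sum DERIV_cmult_right der) (use ij in auto)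
  then show "((\<lambda>t. X t $$ (i, j)) has_real_derivative (B * X t) $$ (i, j)) (at t)"
    using DERIV_shift[of "\<lambda>t. X t $$ (i, j)" "(B * X t) $$ (i, j)" 0 t] ij
    by (simp only: add_0 add index_mult_mat_sum[OF carr(1) carr(1)]
        index_mult_mat_sum[OF carr(2) carr(1)])
qed

text \<open>The product \<open>X (- t) * Y t\<close> is constantly the identity, while
  \<open>X (- t)\<close> is inverse to \<open>X t\<close>.\<close>

lemma one_parameter_group_unique:
  assumes X: "one_parameter_group n X B" and Y: "one_parameter_group n Y B"
  shows "X t = Y t"
proof -
  have carr [simp]: "X t \<in> carrier_mat n n" "Y t \<in> carrier_mat n n" "B \<in> carrier_mat n n" for t
    using X Y by (auto simp: one_parameter_group_def)
  have zero: "X 0 = 1\<^sub>m n" "Y 0 = 1\<^sub>m n"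
    using X Y by (auto simp: one_parameter_group_def)
  have "X (- t) * Y t = 1\<^sub>m n" \<comment> \<open>the left-hand side has derivative \<open>- X (- t) * B * Y t + X (- t) * B * Y t = 0\<close>\<close>
  proof (rule eq_matI)
    fix i j assume "i < dim_row (1\<^sub>m n :: real mat)" "j < dim_col (1\<^sub>m n :: real mat)"
    then have ij: "i < n" "j < n" by auto
    define Z where "Z t = (\<Sum>l<n. X (- t) $$ (i, l) * Y t $$ (l, j))" for t
    have Z: "(X (- t) * Y t) $$ (i, j) = Z t" for t
      unfolding Z_def by (rule index_mult_mat_sum) (use ij in auto)
    have "(Z has_real_derivative 0) (at t)" for t
    proof -
      have dX: "((\<lambda>t. X (- t) $$ (i, l)) has_real_derivative - (X (- t) * B) $$ (i, l)) (at t)"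
        if "l < n" for l
        using DERIV_mirror[of "\<lambda>t. X t $$ (i, l)" "(X (- t) * B) $$ (i, l)" t]
          one_parameter_group_deriv_right[OF X ij(1) that, of "- t"] by simp
      \<comment> \<open>With the right form for \<open>X\<close> and the left form for
        \<open>Y\<close>, \<open>B\<close> stands between the two factors in both summands, so they
        cancel by associativity.\<close>
      have "(Z has_real_derivative (\<Sum>l<n. - (X (- t) * B) $$ (i, l) * Y t $$ (l, j)
          + (B * Y t) $$ (l, j) * X (- t) $$ (i, l))) (at t)"
        unfolding Z_def
        by (intro DERIV_sum DERIV_mult dX one_parameter_group_deriv_left[OF Y _ ij(2)]) auto
      also have "(\<Sum>l<n. - (X (- t) * B) $$ (i, l) * Y t $$ (l, j) + (B * Y t) $$ (l, j) * X (- t) $$ (i, l))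
          = (X (- t) * (B * Y t)) $$ (i, j) - (X (- t) * B * Y t) $$ (i, j)"
        using index_mult_mat_sum[of "X (- t)" n n "B * Y t" n i j]
          index_mult_mat_sum[of "X (- t) * B" n n "Y t" n i j] ij
        by (simp add: sum_subtractf mult_carrier_mat[of _ n n] mult_ac del: index_mult_mat assoc_mult_mat)
      also have "X (- t) * B * Y t = X (- t) * (B * Y t)"
        by (rule assoc_mult_mat[of _ n n _ n _ n]) auto
      finally show ?thesis by simp
    qed
    then have "Z t = Z 0" by (intro DERIV_isconst_all) auto
    also have "Z 0 = 1\<^sub>m n $$ (i, j)" using Z[of 0] by (simp add: zero)
    finally show "(X (- t) * Y t) $$ (i, j) = 1\<^sub>m n $$ (i, j)" by (simp only: Z)
  qed (use carr[THEN carrier_matD(1)] carr[THEN carrier_matD(2)] in auto)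
  then have "X t = X t * (X (- t) * Y t)" using right_mult_one_mat[OF carr(1)] by simp
  also have "\<dots> = X t * X (- t) * Y t"
    by (rule assoc_mult_mat[of _ n n _ n _ n, symmetric]) auto
  also have "X t * X (- t) = X (t + - t)"
    using X unfolding one_parameter_group_def by metis
  finally show ?thesis using left_mult_one_mat[OF carr(2)] by (simp add: zero)
qed

section \<open>Derivatives of compounds and the compound of an exponential\<close>

text \<open>The product rule is applied to each Leibniz term. The explicit value shows that the
  derivative depends on the curve only through its value and its derivative at
  \<open>x\<close>.\<close>

lemma has_derivative_det:
  fixes F :: "real \<Rightarrow> real mat"
  assumes F: "\<And>x. F x \<in> carrier_mat k k"
    and der: "\<And>r s. r < k \<Longrightarrow> s < k \<Longrightarrow> ((\<lambda>x. F x $$ (r, s)) has_real_derivative F' r s) (at x)"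
  shows "((\<lambda>x. det (F x)) has_real_derivative
    (\<Sum>p | p permutes {0..<k}. signof p *
      (\<Sum>r = 0..<k. F' r (p r) * (\<Prod>s \<in> {0..<k} - {r}. F x $$ (s, p s))))) (at x)"
  unfolding det_def'[OF F]
  by (intro DERIV_sum DERIV_cmult has_field_derivative_prod der) (auto simp: permutes_in_image)

text \<open>The additive compound is defined along a straight line through the identity; here it is
  obtained along any curve tangent to that line at 0, in particular along the exponential.\<close>

lemma has_derivative_mult_compound:
  assumes carr: "\<And>x. X x \<in> carrier_mat n n" and A: "A \<in> carrier_mat n n" and one: "X 0 = 1\<^sub>m n"
    and der: "\<And>r s. r < n \<Longrightarrow> s < n \<Longrightarrow>
      ((\<lambda>x. X x $$ (r, s)) has_real_derivative A $$ (r, s)) (at 0)"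
    and ij: "i < n choose k" "j < n choose k"
  shows "((\<lambda>x. mult_compound k (X x) $$ (i, j)) has_real_derivative add_compound k A $$ (i, j)) (at 0)"
proof -
  define I where "I = set (incr_seqs n k ! i)"
  define J where "J = set (incr_seqs n k ! j)"
  have I: "I \<subseteq> {..<n}" "card I = k" and J: "J \<subseteq> {..<n}" "card J = k"
    using incr_seqs_nth ij by (auto simp: I_def J_def)
  have pI: "pick I r < n" and pJ: "pick J r < n" if "r < k" for r
    using that I J pick_in_set_le[of r I] pick_in_set_le[of r J] by auto
  \<comment> \<open>By the Leibniz formula the derivative at \<open>0\<close> depends only on the value \<open>1\<^sub>m n\<close> and the derivative
    \<open>A\<close> of the curve there, so \<open>X\<close> may be compared with the line \<open>1\<^sub>m n + x \<cdot>\<^sub>m A\<close>.\<close>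
  define D where "D = (\<Sum>p | p permutes {0..<k}. signof p * (\<Sum>r = 0..<k. A $$ (pick I r, pick J (p r)) *
      (\<Prod>s \<in> {0..<k} - {r}. submatrix (1\<^sub>m n) I J $$ (s, p s))))"
  have D: "((\<lambda>x. mult_compound k (Y x) $$ (i, j)) has_real_derivative D) (at 0)"
    if Y: "\<And>x. Y x \<in> carrier_mat n n" and one: "Y 0 = 1\<^sub>m n"
      and der: "\<And>r s. r < n \<Longrightarrow> s < n \<Longrightarrow>
        ((\<lambda>x. Y x $$ (r, s)) has_real_derivative A $$ (r, s)) (at 0)" for Y
  proof -
    have sub: "submatrix (Y x) I J = mat k k (\<lambda>(r, s). Y x $$ (pick I r, pick J s))" for x
      using submatrix_eq_mat[OF Y I(1) J(1)] I J by simp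
    have "((\<lambda>x. det (submatrix (Y x) I J)) has_real_derivative D) (at 0)"
      unfolding D_def one[symmetric]
      by (rule has_derivative_det) (auto simp: sub pI pJ intro!: der)
    then show ?thesis
      using carrier_matD[OF Y] ij by (simp add: mult_compound_def I_def J_def)
  qed
  \<comment> \<open>The line is itself such a curve, so uniqueness of derivatives identifies
    \<open>D\<close> with the entry of the additive compound.\<close>
  have "((\<lambda>x. mult_compound k (1\<^sub>m n + x \<cdot>\<^sub>m A) $$ (i, j)) has_real_derivative D) (at 0)"
    by (rule D) (use A in \<open>auto intro!: derivative_eq_intros\<close>)
  then have "D = add_compound k A $$ (i, j)"
    using mult_compound_has_derivative[OF A ij] DERIV_unique by blast
  then show ?thesis using D[OF carr one der] by simp
qed

text \<open>Both sides are one-parameter groups with generator \<open>add_compound k A\<close>; for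
  the left side the group law comes from \<open>mult_compound_mult\<close>.\<close>

lemma mult_compound_mat_exp:
  fixes A :: "real mat"
  assumes A: "A \<in> carrier_mat n n"
  shows "mult_compound k (mat_exp (t \<cdot>\<^sub>m A)) = mat_exp (t \<cdot>\<^sub>m add_compound k A)"
proof -
  have "one_parameter_group (n choose k) (\<lambda>t. mult_compound k (mat_exp (t \<cdot>\<^sub>m A))) (add_compound k A)"
    unfolding one_parameter_group_def
  proof (intro conjI allI impI)
    show "add_compound k A \<in> carrier_mat (n choose k) (n choose k)"
      using A by (simp add: add_compound_def)
    show "mult_compound k (mat_exp (0 \<cdot>\<^sub>m A)) = 1\<^sub>m (n choose k)"
      by (simp add: mat_exp_zero[OF A] mult_compound_one)
    show "mult_compound k (mat_exp ((s + t) \<cdot>\<^sub>m A)) =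
        mult_compound k (mat_exp (s \<cdot>\<^sub>m A)) * mult_compound k (mat_exp (t \<cdot>\<^sub>m A))" for s t
      unfolding mat_exp_add[OF A] by (rule mult_compound_mult[of _ n n _ n]) (use A in auto)
    show "((\<lambda>t. mult_compound k (mat_exp (t \<cdot>\<^sub>m A)) $$ (i, j)) has_real_derivative
        add_compound k A $$ (i, j)) (at 0)" if "i < n choose k" "j < n choose k" for i j
      by (rule has_derivative_mult_compound)
        (use A that mat_exp_zero[OF A] mat_exp_has_derivative_0[OF A] in auto)
  qed (use A in auto)
  moreover have "add_compound k A \<in> carrier_mat (n choose k) (n choose k)"
    using A by (simp add: add_compound_def)
  ultimately show ?thesis
    using one_parameter_group_unique one_parameter_group_mat_exp by blast
qed

section \<open>Principal minors and P-matrices\<close>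

text \<open>The determinant at \<open>- t\<close> is the reciprocal of the one at \<open>t\<close>,
  which is therefore nonzero; being the square of the one at \<open>t / 2\<close>, it is
  positive.\<close>

lemma det_mat_exp_pos:
  fixes A :: "real mat"
  assumes A: "A \<in> carrier_mat n n"
  shows "det (mat_exp (t \<cdot>\<^sub>m A)) > 0"
proof -
  have det_add: "det (mat_exp ((s + u) \<cdot>\<^sub>m A)) = det (mat_exp (s \<cdot>\<^sub>m A)) * det (mat_exp (u \<cdot>\<^sub>m A))" for s u
    unfolding mat_exp_add[OF A] by (rule det_mult[of _ n]) (use A in auto)
  have "det (mat_exp (t \<cdot>\<^sub>m A)) * det (mat_exp ((- t) \<cdot>\<^sub>m A)) = 1"
    using det_add[of t "- t"] by (simp add: mat_exp_zero[OF A])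
  then have "det (mat_exp (t \<cdot>\<^sub>m A)) \<noteq> 0" by auto
  moreover have "det (mat_exp (t \<cdot>\<^sub>m A)) = (det (mat_exp ((t / 2) \<cdot>\<^sub>m A)))\<^sup>2"
    using det_add[of "t / 2" "t / 2"] by (simp add: power2_eq_square)
  ultimately show ?thesis by simp
qed

text \<open>The diagonal positions of the compound run through all \<open>k\<close>-subsets, so its
  diagonal lists the principal \<open>k\<close>-minors.\<close>

lemma mult_compound_diag_pos_iff:
  assumes "M \<in> carrier_mat n n"
  shows "(\<forall>i < n choose k. mult_compound k M $$ (i, i) > 0) \<longleftrightarrow>
    (\<forall>I. I \<subseteq> {..<n} \<and> card I = k \<longrightarrow> det (submatrix M I I) > 0)"
proof -
  have "(\<forall>i < n choose k. mult_compound k M $$ (i, i) > 0) \<longleftrightarrow>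
      (\<forall>I \<in> (\<lambda>i. set (incr_seqs n k ! i)) ` {..<n choose k}. det (submatrix M I I) > 0)"
    using assms by (auto simp: mult_compound_def)
  then show ?thesis
    by (simp add: bij_betw_imp_surj_on[OF bij_betw_incr_seqs])
qed

lemma submatrix_full:
  assumes M: "M \<in> carrier_mat m n"
  shows "submatrix M {..<m} {..<n} = M"
proof -
  have "pick {..<m} i = i" if "i < m" for m i
  proof -
    have "{a \<in> {..<m}. a < i} = {..<i}" using that by auto
    then show ?thesis using pick_card_in_set[of i "{..<m}"] that by simp
  qed
  then show ?thesis
    using M by (intro eq_matI) (auto simp: submatrix_eq_mat[OF M order_refl order_refl])
qed

text \<open>The principal minors are sorted by size. The only one of size \<open>n\<close> is
  \<open>det M\<close>, which is positive by assumption. For \<open>n\<close> at most 1 the range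
  \<open>{1..n - 1}\<close> is empty, in accordance with this.\<close>

lemma P_matrix_iff_mult_compound:
  assumes M: "M \<in> carrier_mat n n" and "det M > 0"
  shows "P_matrix M \<longleftrightarrow> (\<forall>k \<in> {1..n - 1}. \<forall>i < n choose k. mult_compound k M $$ (i, i) > 0)"
proof -
  have "card I \<in> {1..n - 1} \<or> det (submatrix M I I) > 0" if I: "I \<subseteq> {..<n}" "I \<noteq> {}" for I
  proof (cases "I = {..<n}")
    case True
    then show ?thesis using assms submatrix_full[OF M] by simp
  next
    case False
    then have "card I < n" using I psubset_card_mono[of "{..<n}" I] by auto
    moreover have "card I > 0" using I finite_subset[of I "{..<n}"] by (simp add: card_gt_0_iff)
    ultimately show ?thesis by auto
  qed
  moreover have "I \<noteq> {}" if "card I \<in> {1..n - 1}" for I :: "nat set"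
    using that by auto
  ultimately have "(\<forall>I. I \<subseteq> {..<n} \<and> I \<noteq> {} \<longrightarrow> det (submatrix M I I) > 0) \<longleftrightarrow>
      (\<forall>k \<in> {1..n - 1}. \<forall>I. I \<subseteq> {..<n} \<and> card I = k \<longrightarrow> det (submatrix M I I) > 0)"
    by blast
  then show ?thesis
    using M by (simp add: P_matrix_def mult_compound_diag_pos_iff[OF M])
qed

theorem proposition2:
  fixes A :: "real mat" and n :: nat
  assumes "A \<in> carrier_mat n n"
  shows "EP_matrix A \<longleftrightarrow>
    (\<forall>t\<ge>0. \<forall>k\<in>{1..n - 1}. \<forall>i < n choose k. mat_exp (t \<cdot>\<^sub>m add_compound k A) $$ (i, i) > 0)"
proof -
  \<comment> \<open>The equivalence holds for each \<open>t\<close> separately; the quantifier over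
    \<open>t\<close> is added afterwards.\<close>
  have "P_matrix (mat_exp (t \<cdot>\<^sub>m A)) \<longleftrightarrow>
      (\<forall>k\<in>{1..n - 1}. \<forall>i < n choose k. mat_exp (t \<cdot>\<^sub>m add_compound k A) $$ (i, i) > 0)" for t
    using assms P_matrix_iff_mult_compound[of "mat_exp (t \<cdot>\<^sub>m A)" n] det_mat_exp_pos
    by (simp only: mult_compound_mat_exp smult_carrier_mat mat_exp_carrier)
  then show ?thesis using assms by (simp add: EP_matrix_def)
qed

end
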